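(* Let $\mathcal{D}$ be a $2-(v,k,1)$ design, $k\geq4$, with $r=\frac{v-1}{k-1}\geq k^{2}-3k+\frac{3}{4}\sqrt{k}+2$, and let $\mathcal{S}$ be an Erdős-Ko-Rado set on $\mathcal{D}$. Then $|\mathcal{S}|\leq r$. If $r\neq k^{2}-k+1$ and $(r,k)\neq(8,4)$, then $|\mathcal{S}|=r$ if and only if $\mathcal{S}$ is a point-pencil.
   Context: A $2-(v,k,1)$ design, with integers $v>k>1$, consists of a set $\mathcal{P}$ of $v$ points together with a set $\mathcal{B}$ of $k$-subsets of $\mathcal{P}$ (blocks) such that any two distinct points are contained in exactly one block. Every point then lies on exactly $r=\frac{v-1}{k-1}$ blocks. An Erdős-Ko-Rado set on a design is a set of pairwise intersecting blocks. A point-pencil is the set of all blocks through a fixed point. *)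

theory Defs
  imports Complex_Main
begin

text \<open>
  Since \<open>1 < k < v\<close> and \<open>card\<close> of an infinite set is 0, the conditions on
  cardinalities force the point set and all blocks to be finite.
\<close>
definition design :: "'a set \<Rightarrow> 'a set set \<Rightarrow> nat \<Rightarrow> nat \<Rightarrow> bool" where
  "design P \<B> v k \<longleftrightarrow>
     1 < k \<and> k < v \<and> card P = v \<and>
     (\<forall>b\<in>\<B>. b \<subseteq> P \<and> card b = k) \<and>
     (\<forall>x\<in>P. \<forall>y\<in>P. x \<noteq> y \<longrightarrow> (\<exists>!b. b \<in> \<B> \<and> x \<in> b \<and> y \<in> b))"

definition EKR_set :: "'a set set \<Rightarrow> 'a set set \<Rightarrow> bool" where
  "EKR_set \<B> S \<longleftrightarrow> S \<subseteq> \<B> \<and> pairwise (\<lambda>b c. b \<inter> c \<noteq> {}) S"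

definition point_pencil :: "'a set \<Rightarrow> 'a set set \<Rightarrow> 'a set set \<Rightarrow> bool" where
  "point_pencil P \<B> S \<longleftrightarrow> (\<exists>p\<in>P. S = {b \<in> \<B>. p \<in> b})"

end

theory Submission
  imports Defs
begin

text \<open>
  Let \<open>S\<close> be an intersecting family that is contained in no point-pencil, with \<open>s = |S| \<ge> r\<close>, and
  let \<open>U\<close> be the union of its blocks, \<open>u = |U|\<close>. Write \<open>i\<close> for the size of \<open>L \<inter> U\<close>, \<open>L\<close> a block.
  Counting the incidences between the points outside \<open>U\<close> and the blocks, and using
  \<open>2 (k - i) (i - 1) \<le> (k - 2) i (i - 1)\<close>, one gets
  \<open>2 (v - u) (u - r) \<le> (k - 2) (u (u - 1) - s k (k - 1))\<close>.
  With \<open>n = k - 1\<close> and \<open>x = u - r\<close>, this reads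
  \<open>(n - 1) (r (n\<^sup>2 + n + 1 - r) + (s - r) n (n + 1)) \<le> (n + 1) x (x - 1)\<close>.

  Every point lies on at most \<open>k\<close> blocks of \<open>S\<close>, whence \<open>s \<le> n\<^sup>2 + n + 1\<close>; so let
  \<open>r < n\<^sup>2 + n + 1\<close>. If some point lies on exactly \<open>k\<close> blocks of \<open>S\<close>, then \<open>u = n\<^sup>2 + n + 1\<close>, and
  the inequality gives \<open>2 r \<le> k\<^sup>2\<close>, that is, \<open>(r, k) = (8, 4)\<close>. Otherwise all degrees of points of
  \<open>U\<close> lie between \<open>t = s - n (n - 1)\<close> and \<open>n\<close>; the sum of \<open>(d - t) (n - d)\<close> over the degrees \<open>d\<close>
  is nonnegative, which means \<open>u \<le> s (1 + 1 / t)\<close>, and this contradicts the inequality.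
\<close>

section \<open>Degrees and weighted double counting\<close>

definition deg :: "'a set set \<Rightarrow> 'a \<Rightarrow> nat"
  where "deg S p = card {b \<in> S. p \<in> b}"

text \<open>Flags (p, b) are counted with weight \<open>f p\<close>. The weights 1 and
  \<open>deg S p\<close> later give the first and second moments of the degrees.\<close>

lemma sum_deg_mult:
  fixes f :: "'a \<Rightarrow> real"
  assumes "finite S" "finite A"
  shows "(\<Sum>p\<in>A. real (deg S p) * f p) = (\<Sum>b\<in>S. \<Sum>p\<in>b \<inter> A. f p)"
proof -
  have "(\<Sum>p\<in>A. real (deg S p) * f p) = (\<Sum>p\<in>A. \<Sum>b\<in>{b \<in> S. p \<in> b}. f p)"
    by (simp add: deg_def)
  also have "\<dots> = (\<Sum>b\<in>S. \<Sum>p\<in>{p \<in> A. p \<in> b}. f p)"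
    by (rule sum.swap_restrict[OF assms(2,1)])
  also have "\<dots> = (\<Sum>b\<in>S. \<Sum>p\<in>b \<inter> A. f p)"
    by (intro sum.cong) auto
  finally show ?thesis .
qed

lemma sum_deg:
  assumes "finite S" "finite A"
  shows "(\<Sum>p\<in>A. real (deg S p)) = (\<Sum>b\<in>S. real (card (b \<inter> A)))"
  using sum_deg_mult[OF assms, of "\<lambda>_. 1"] by simp

section \<open>Two numerical inequalities that contradict each other\<close>

text \<open>In the application n = k - 1 and t = r - n (n - 1), and the last hypothesis is the
  square of t >= 3/4 sqrt k. Integrality is essential: it gives t <= n - 1 when t differs from n,
  and t >= 2 in the second case.\<close>

lemma size_gap_inequality:
  fixes n t :: int
  assumes "3 \<le> n" "0 < t" "t \<le> n" "9 * (n + 1) \<le> 16 * t\<^sup>2"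
  shows "n * (n + 1) < t\<^sup>2 * (2 * n + 1 - t)"
proof (cases "n \<le> t\<^sup>2")
  case True
  show ?thesis
  proof (cases "t = n")
    case True
    have "1 * (n * (n + 1)) < n * (n * (n + 1))"
      using assms by (intro mult_strict_right_mono) auto
    thus ?thesis using True by (simp add: power2_eq_square algebra_simps)
  next
    case False
    have "n * (n + 1) < n * (n + 2)" using assms by simp
    also have "\<dots> \<le> t\<^sup>2 * (2 * n + 1 - t)"
      using assms False True by (intro mult_mono) auto
    finally show ?thesis .
  qed
next
  case False
  have "t \<noteq> 1" using assms by auto
  \<comment> \<open>The product is negative only strictly between 2 and 5/2, where there is no
    integer. Together with t^2 <= n - 1 it yields 9 t <= 2 n + 8.\<close>
  then have "0 \<le> (t - 2) * (2 * t - 5)"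
    using assms by (cases "t = 2") auto
  then have "16 * n < 9 * (2 * n + 1 - t)"
    using False by (simp add: power2_eq_square algebra_simps)
  then have "(n + 1) * (16 * n) < (n + 1) * (9 * (2 * n + 1 - t))"
    using assms by simp
  also have "\<dots> = 9 * (n + 1) * (2 * n + 1 - t)" by (simp add: algebra_simps)
  also have "\<dots> \<le> 16 * t\<^sup>2 * (2 * n + 1 - t)"
    using assms by (intro mult_right_mono) auto
  finally show ?thesis by (simp add: algebra_simps)
qed

text \<open>Put x = u - r. The bound u <= s (1 + 1 / t') carries over from s to r as t x <= r.
  Multiplying \<open>ineq\<close> by t^2 then bounds its right side by (n + 1) r (r - t); since r -
  t = n (n - 1), the factor r (n - 1) cancels.\<close>

lemma low_degree_inequality:
  fixes n r s u t t' :: real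
  assumes "1 < n" "0 < t" "t \<le> t'" "t = t' \<or> t * t' \<le> n * (n - 1)"
    and r: "r = n * (n - 1) + t" and s: "s = n * (n - 1) + t'"
    and u: "t' * u \<le> s * (t' + 1)" "r \<le> u"
    and ineq: "(n - 1) * (r * (n * n + n + 1 - r) + (s - r) * n * (n + 1))
               \<le> (n + 1) * (u - r) * (u - r - 1)"
  shows "t\<^sup>2 * (2 * n + 1 - t) \<le> n * (n + 1)"
proof -
  have r_pos: "0 < r" and nn: "0 < n * (n - 1)" using assms by (auto intro!: add_pos_pos)
  have tx: "t * (u - r) \<le> r"
  proof -
    \<comment> \<open>This pays for the excess s - r = t' - t; it is why t = t' or t t' <= n (n - 1)
      is assumed.\<close>
    have "t * t' * (t' - t) \<le> n * (n - 1) * (t' - t)"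
    proof (cases "t = t'")
      case False
      then show ?thesis using assms by (intro mult_right_mono) auto
    qed simp
    moreover have "t * (t' * u) \<le> t * (s * (t' + 1))"
      using u assms by simp
    ultimately have "t' * (t * (u - r)) \<le> t' * r"
      unfolding r s by (simp add: algebra_simps)
    thus ?thesis using assms by simp
  qed
  have "(t * (u - r)) * (t * (u - r) - t) \<le> r * (r - t)"
  proof (cases "t \<le> t * (u - r)")
    case True
    thus ?thesis using tx r_pos u assms by (intro mult_mono) auto
  next
    case False
    then have "(t * (u - r)) * (t * (u - r) - t) \<le> 0"
      using assms by (intro mult_nonneg_nonpos) auto
    also have "\<dots> \<le> r * (r - t)" using r_pos nn r by simp
    finally show ?thesis .
  qed
  then have upper: "(n + 1) * ((t * (u - r)) * (t * (u - r) - t)) \<le> (n + 1) * (r * (r - t))"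
    using assms by simp
  have "0 \<le> (n - 1) * ((s - r) * n * (n + 1))" using assms by simp
  then have "(n - 1) * (r * (n * n + n + 1 - r)) \<le> (n + 1) * (u - r) * (u - r - 1)"
    using ineq by (simp add: distrib_left)
  then have "t\<^sup>2 * ((n - 1) * (r * (n * n + n + 1 - r)))
      \<le> t\<^sup>2 * ((n + 1) * (u - r) * (u - r - 1))"
    by (intro mult_left_mono) auto
  also have "\<dots> = (n + 1) * ((t * (u - r)) * (t * (u - r) - t))"
    by (simp add: power2_eq_square algebra_simps)
  also note upper
  also have "n * n + n + 1 - r = 2 * n + 1 - t" using r by (simp add: algebra_simps)
  also have "r - t = n * (n - 1)" using r by simp
  finally have "(r * (n - 1)) * (t\<^sup>2 * (2 * n + 1 - t)) \<le> (r * (n - 1)) * (n * (n + 1))"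
    by (simp only: mult_ac)
  thus ?thesis using r_pos assms by simp
qed

section \<open>Counting in a design\<close>

locale block_design =
  fixes P :: "'a set" and \<B> :: "'a set set" and v k :: nat
  assumes design: "design P \<B> v k"
begin

lemma k_gt_1: "1 < k" and k_less_v: "k < v" and card_P: "card P = v"
  and block_subset: "b \<in> \<B> \<Longrightarrow> b \<subseteq> P" and card_block: "b \<in> \<B> \<Longrightarrow> card b = k"
  using design by (auto simp: design_def)

lemma finite_P: "finite P"
  using card_P k_less_v by (intro card_ge_0_finite) simp

lemma finite_blocks: "finite \<B>"
  using finite_subset[of \<B> "Pow P"] block_subset finite_P by auto

lemma finite_block: "b \<in> \<B> \<Longrightarrow> finite b"
  using block_subset finite_P finite_subset by blast

lemma block_through:
  assumes "x \<in> P" "y \<in> P" "x \<noteq> y"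
  obtains b where "b \<in> \<B>" "x \<in> b" "y \<in> b"
  using design assms unfolding design_def by metis

lemma block_unique:
  assumes "b \<in> \<B>" "c \<in> \<B>" "x \<in> b" "y \<in> b" "x \<in> c" "y \<in> c" "x \<noteq> y"
  shows "b = c"
proof -
  have "x \<in> P" "y \<in> P" using assms block_subset by auto
  thus ?thesis using design assms unfolding design_def by metis
qed

lemma sum_card_blocks_through:
  assumes "x \<in> P" "U \<subseteq> P" "x \<notin> U"
  shows "(\<Sum>b\<in>{b \<in> \<B>. x \<in> b}. real (card (b \<inter> U))) = card U"
proof -
  have "finite U" using assms finite_P finite_subset by blast
  have one: "deg {b \<in> \<B>. x \<in> b} y = 1" if "y \<in> U" for y
  proof -
    have "y \<in> P" "x \<noteq> y" using that assms by auto
    then obtain b where b: "b \<in> \<B>" "x \<in> b" "y \<in> b"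
      using block_through[OF assms(1)] by blast
    have "c = b" if "c \<in> \<B>" "x \<in> c" "y \<in> c" for c
      using block_unique[of c b x y] that b \<open>x \<noteq> y\<close> by simp
    then have "{c \<in> {b \<in> \<B>. x \<in> b}. y \<in> c} = {b}" using b by blast
    thus ?thesis by (simp add: deg_def)
  qed
  have "(\<Sum>b\<in>{b \<in> \<B>. x \<in> b}. real (card (b \<inter> U))) = (\<Sum>y\<in>U. real (deg {b \<in> \<B>. x \<in> b} y))"
    using sum_deg[of "{b \<in> \<B>. x \<in> b}" U] finite_blocks \<open>finite U\<close> by simp
  also have "\<dots> = card U" by (simp add: one)
  finally show ?thesis .
qed

lemma deg_blocks:
  assumes "x \<in> P"
  shows "real (deg \<B> x) * (real k - 1) = real v - 1"
proof -
  have c: "card (b \<inter> (P - {x})) = k - 1" if "b \<in> \<B>" "x \<in> b" for b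
  proof -
    have "b \<inter> (P - {x}) = b - {x}" using block_subset that by auto
    thus ?thesis using card_block finite_block that by simp
  qed
  have "(\<Sum>b\<in>{b \<in> \<B>. x \<in> b}. real (card (b \<inter> (P - {x})))) = card (P - {x})"
    using sum_card_blocks_through[of x "P - {x}"] assms by auto
  thus ?thesis
    using c assms finite_P card_P k_gt_1 k_less_v by (simp add: deg_def of_nat_diff)
qed

text \<open>Both sides count ordered pairs of distinct points of \<open>U\<close>, each pair lying
  in exactly one block.\<close>

lemma sum_pairs_in_blocks:
  assumes "U \<subseteq> P"
  shows "(\<Sum>b\<in>\<B>. real (card (b \<inter> U)) * (real (card (b \<inter> U)) - 1))
         = real (card U) * (real (card U) - 1)"
proof -
  have fin: "finite U" using assms finite_P finite_subset by blast
  have c: "real (card (b \<inter> (U - {x}))) = real (card (b \<inter> U)) - 1" if "x \<in> U" "x \<in> b" for b x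
  proof -
    have "b \<inter> (U - {x}) = b \<inter> U - {x}" by auto
    moreover have "card (b \<inter> U) > 0" using that fin by (auto simp: card_gt_0_iff)
    ultimately show ?thesis using that fin by (simp add: of_nat_diff)
  qed
  have "(\<Sum>b\<in>\<B>. real (card (b \<inter> U)) * (real (card (b \<inter> U)) - 1))
        = (\<Sum>b\<in>\<B>. \<Sum>x\<in>{x \<in> U. x \<in> b}. real (card (b \<inter> (U - {x}))))"
  proof (intro sum.cong refl)
    fix b
    have "{x \<in> U. x \<in> b} = b \<inter> U" by auto
    thus "real (card (b \<inter> U)) * (real (card (b \<inter> U)) - 1)
          = (\<Sum>x\<in>{x \<in> U. x \<in> b}. real (card (b \<inter> (U - {x}))))"
      using c[of _ b] by simp
  qed
  also have "\<dots> = (\<Sum>x\<in>U. \<Sum>b\<in>{b \<in> \<B>. x \<in> b}. real (card (b \<inter> (U - {x}))))"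
    by (rule sum.swap_restrict[OF finite_blocks fin])
  also have "\<dots> = (\<Sum>x\<in>U. real (card (U - {x})))"
    using assms by (intro sum.cong refl sum_card_blocks_through) auto
  also have "\<dots> = (\<Sum>x\<in>U. real (card U) - 1)"
  proof (intro sum.cong refl)
    fix x assume "x \<in> U"
    then have "card U > 0" using fin by (auto simp: card_gt_0_iff)
    thus "real (card (U - {x})) = real (card U) - 1"
      using \<open>x \<in> U\<close> fin by (simp add: of_nat_diff)
  qed
  finally show ?thesis by simp
qed

text \<open>Over the R blocks through a point outside the union, the sizes i add up to u, so the
  numbers i - 1 add up to u - R. Summed over all outer points, each block gets weight k - i. Blocks
  of \<open>S\<close> have i = k and drop out; the others are bounded by the pairs of points of the
  union not joined by a block of \<open>S\<close>.\<close>

lemma outer_point_inequality: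
  assumes "S \<subseteq> \<B>" and R: "\<And>x. x \<in> P \<Longrightarrow> deg \<B> x = R"
  defines "u \<equiv> real (card (\<Union>S))"
  shows "2 * (real v - u) * (u - real R)
         \<le> (real k - 2) * (u * (u - 1) - real (card S) * real k * (real k - 1))"
proof -
  define i where "i b = real (card (b \<inter> \<Union>S))" for b
  have UP: "\<Union>S \<subseteq> P" using assms block_subset by blast
  have fin: "finite (\<Union>S)" using UP finite_P finite_subset by blast
  have out: "real (card (b \<inter> (P - \<Union>S))) = real k - i b" if "b \<in> \<B>" for b
  proof -
    have "b \<inter> (P - \<Union>S) = b - b \<inter> \<Union>S" using block_subset that by auto
    moreover have "card (b \<inter> \<Union>S) \<le> card b" by (intro card_mono finite_block that) auto
    ultimately show ?thesis
      using finite_block[OF that] card_block[OF that]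
      by (simp add: i_def card_Diff_subset of_nat_diff)
  qed
  have iS: "i b = k" if "b \<in> S" for b
  proof -
    have "b \<inter> \<Union>S = b" using that by auto
    thus ?thesis using that assms card_block by (auto simp: i_def)
  qed
  \<comment> \<open>The difference of the two sides is k (i - 1) (i - 2), nonnegative at every
    integer i.\<close>
  have le: "2 * ((real k - i b) * (i b - 1)) \<le> (real k - 2) * (i b * (i b - 1))" for b
  proof -
    have "card (b \<inter> \<Union>S) = 0 \<or> card (b \<inter> \<Union>S) = 1 \<or> card (b \<inter> \<Union>S) \<ge> 2" by linarith
    then have "i b = 0 \<or> i b = 1 \<or> i b \<ge> 2" unfolding i_def by auto
    moreover have "0 \<le> real k * (i b - 2) * (i b - 1)" if "i b \<ge> 2"
      using that by simp
    ultimately show ?thesis by (auto simp: algebra_simps)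
  qed
  have "(real v - u) * (u - real R) = (\<Sum>x\<in>P - \<Union>S. u - real R)"
    using UP fin finite_P card_P card_mono[OF finite_P UP]
    by (simp add: card_Diff_subset of_nat_diff u_def)
  also have "\<dots> = (\<Sum>x\<in>P - \<Union>S. \<Sum>b\<in>{b \<in> \<B>. x \<in> b}. i b - 1)"
  proof (intro sum.cong refl)
    fix x assume x: "x \<in> P - \<Union>S"
    have "(\<Sum>b\<in>{b \<in> \<B>. x \<in> b}. i b) = u"
      unfolding i_def u_def using x UP by (intro sum_card_blocks_through) auto
    thus "u - real R = (\<Sum>b\<in>{b \<in> \<B>. x \<in> b}. i b - 1)"
      using R[of x] x by (simp add: sum_subtractf deg_def)
  qed
  also have "\<dots> = (\<Sum>b\<in>\<B>. \<Sum>x\<in>{x \<in> P - \<Union>S. x \<in> b}. i b - 1)"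
    using finite_P by (intro sum.swap_restrict finite_blocks) auto
  also have "\<dots> = (\<Sum>b\<in>\<B>. (real k - i b) * (i b - 1))"
  proof (intro sum.cong refl)
    fix b assume b: "b \<in> \<B>"
    have "{x \<in> P - \<Union>S. x \<in> b} = b \<inter> (P - \<Union>S)" by auto
    thus "(\<Sum>x\<in>{x \<in> P - \<Union>S. x \<in> b}. i b - 1) = (real k - i b) * (i b - 1)"
      using out[OF b] by simp
  qed
  also have "\<dots> = (\<Sum>b\<in>\<B> - S. (real k - i b) * (i b - 1))"
    using iS by (intro sum.mono_neutral_right finite_blocks) auto
  finally have "2 * (real v - u) * (u - real R)
      = (\<Sum>b\<in>\<B> - S. 2 * ((real k - i b) * (i b - 1)))"
    by (simp only: sum_distrib_left mult.assoc)
  also have "\<dots> \<le> (\<Sum>b\<in>\<B> - S. (real k - 2) * (i b * (i b - 1)))"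
    by (intro sum_mono le)
  also have "\<dots> = (real k - 2) * ((\<Sum>b\<in>\<B>. i b * (i b - 1)) - (\<Sum>b\<in>S. i b * (i b - 1)))"
    using assms by (simp add: sum_distrib_left[symmetric] sum_diff finite_blocks)
  also have "(\<Sum>b\<in>\<B>. i b * (i b - 1)) = u * (u - 1)"
    unfolding i_def u_def by (rule sum_pairs_in_blocks[OF UP])
  also have "(\<Sum>b\<in>S. i b * (i b - 1)) = card S * real k * (real k - 1)"
    using iS by simp
  finally show ?thesis .
qed

end

section \<open>Degrees in an intersecting family\<close>

locale intersecting_family = block_design +
  fixes S :: "'a set set"
  assumes ekr: "EKR_set \<B> S"
begin

lemma S_blocks: "S \<subseteq> \<B>"
  using ekr by (simp add: EKR_set_def)

lemma finite_S: "finite S"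
  using S_blocks finite_blocks finite_subset by blast

lemma finite_union: "finite (\<Union>S)"
  using S_blocks finite_S finite_block by auto

lemma card_inter:
  assumes "b \<in> S" "c \<in> S" "b \<noteq> c"
  shows "card (c \<inter> b) = 1"
proof -
  have "b \<inter> c \<noteq> {}" using ekr assms by (auto simp: EKR_set_def pairwise_def)
  then obtain x where x: "x \<in> b" "x \<in> c" by auto
  have "c \<inter> b = {x}" using x block_unique[of b c x] assms S_blocks by blast
  thus ?thesis by simp
qed

text \<open>Each other block of \<open>S\<close> meets b in exactly one point, and b itself
  contributes k.\<close>

lemma sum_deg_block:
  assumes "b \<in> S"
  shows "(\<Sum>p\<in>b. real (deg S p)) = real (card S) + real k - 1"
proof -
  have b: "b \<in> \<B>" using assms S_blocks by auto
  have "card S > 0" using assms finite_S by (auto simp: card_gt_0_iff)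
  have "(\<Sum>p\<in>b. real (deg S p)) = (\<Sum>c\<in>S. real (card (c \<inter> b)))"
    by (rule sum_deg[OF finite_S finite_block[OF b]])
  also have "\<dots> = real (card b) + (\<Sum>c\<in>S - {b}. real (card (c \<inter> b)))"
    using sum.remove[OF finite_S assms, of "\<lambda>c. real (card (c \<inter> b))"] by simp
  also have "(\<Sum>c\<in>S - {b}. real (card (c \<inter> b))) = (\<Sum>c\<in>S - {b}. 1)"
    using assms card_inter by (intro sum.cong) auto
  finally show ?thesis
    using card_block[OF b] assms finite_S \<open>card S > 0\<close> by (simp add: of_nat_diff)
qed

lemma sum_deg_union: "(\<Sum>p\<in>\<Union>S. real (deg S p)) = real (card S) * real k"
proof -
  have "(\<Sum>p\<in>\<Union>S. real (deg S p)) = (\<Sum>b\<in>S. real (card (b \<inter> \<Union>S)))"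
    by (rule sum_deg[OF finite_S finite_union])
  also have "\<dots> = (\<Sum>b\<in>S. real k)"
  proof (intro sum.cong refl)
    fix b assume "b \<in> S"
    then have "b \<inter> \<Union>S = b" "card b = k" using S_blocks card_block by auto
    thus "real (card (b \<inter> \<Union>S)) = real k" by simp
  qed
  finally show ?thesis by simp
qed

lemma sum_deg_square_union:
  "(\<Sum>p\<in>\<Union>S. real (deg S p) * real (deg S p)) = real (card S) * (real (card S) + real k - 1)"
proof -
  have "(\<Sum>p\<in>\<Union>S. real (deg S p) * real (deg S p)) = (\<Sum>b\<in>S. \<Sum>p\<in>b \<inter> \<Union>S. real (deg S p))"
    by (rule sum_deg_mult[OF finite_S finite_union])
  also have "\<dots> = (\<Sum>b\<in>S. real (card S) + real k - 1)"
  proof (intro sum.cong refl)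
    fix b assume "b \<in> S"
    then have "b \<inter> \<Union>S = b" by auto
    thus "(\<Sum>p\<in>b \<inter> \<Union>S. real (deg S p)) = real (card S) + real k - 1"
      using sum_deg_block[OF \<open>b \<in> S\<close>] by simp
  qed
  finally show ?thesis by simp
qed

lemma deg_through_le_1:
  assumes "p \<noteq> q"
  shows "deg {c \<in> S. p \<in> c} q \<le> 1"
proof -
  have "c = d" if "c \<in> S" "d \<in> S" "p \<in> c" "p \<in> d" "q \<in> c" "q \<in> d" for c d
    using block_unique[of c d p q] that assms S_blocks by blast
  thus ?thesis
    unfolding deg_def One_nat_def using finite_S by (subst card_le_Suc0_iff_eq) auto
qed

text \<open>The blocks of \<open>S\<close> through p are sorted by the single point in which each
  meets b. Each class has at most one member, so p has degree at most k.\<close>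

lemma deg_eq_sum:
  assumes "b \<in> S" "p \<notin> b"
  shows "deg S p = (\<Sum>q\<in>b. deg {c \<in> S. p \<in> c} q)"
proof -
  have "(\<Sum>q\<in>b. real (deg {c \<in> S. p \<in> c} q)) = (\<Sum>c\<in>{c \<in> S. p \<in> c}. real (card (c \<inter> b)))"
    using sum_deg[of "{c \<in> S. p \<in> c}" b] finite_S finite_block assms S_blocks by auto
  also have "\<dots> = (\<Sum>c\<in>{c \<in> S. p \<in> c}. 1)"
    using assms card_inter[of b] by (intro sum.cong) auto
  finally have "real (\<Sum>q\<in>b. deg {c \<in> S. p \<in> c} q) = real (deg S p)"
    by (simp add: deg_def)
  thus ?thesis using of_nat_eq_iff[where 'a = real] by metis
qed

lemma deg_le:
  assumes "b \<in> S" "p \<notin> b"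
  shows "deg S p \<le> k"
proof -
  have "(\<Sum>q\<in>b. deg {c \<in> S. p \<in> c} q) \<le> (\<Sum>q\<in>b. 1)"
    using assms by (intro sum_mono deg_through_le_1) auto
  also have "\<dots> = k" using card_block assms S_blocks by auto
  finally show ?thesis using deg_eq_sum[OF assms] by simp
qed

text \<open>Equality in \<open>deg_le\<close>: for a block b of \<open>S\<close> through q but not
  p, the k blocks of \<open>S\<close> through p use up all k points of b, in particular q.\<close>

lemma joined_if_deg_eq:
  assumes "deg S p = k" "q \<in> \<Union>S"
  shows "\<exists>c\<in>S. p \<in> c \<and> q \<in> c"
proof -
  obtain b where b: "b \<in> S" "q \<in> b" using assms by auto
  show ?thesis
  proof (cases "p \<in> b")
    case True
    thus ?thesis using b by auto
  next
    case False
    show ?thesis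
    proof (rule ccontr)
      assume "\<not> ?thesis"
      then have "{c \<in> {c \<in> S. p \<in> c}. q \<in> c} = {}" by blast
      then have "deg {c \<in> S. p \<in> c} q = 0" by (simp only: deg_def card.empty)
      moreover have "deg {c \<in> S. p \<in> c} q' \<le> 1" if "q' \<in> b" for q'
        using that False by (intro deg_through_le_1) auto
      ultimately have "(\<Sum>q\<in>b. deg {c \<in> S. p \<in> c} q) < (\<Sum>q\<in>b. 1)"
        using b finite_block S_blocks by (intro sum_strict_mono_ex1) force+
      moreover have "card b = k" using card_block b S_blocks by auto
      ultimately show False using deg_eq_sum[OF b(1) False] assms by simp
    qed
  qed
qed

text \<open>The k blocks of \<open>S\<close> through p cover the whole union and share only p, which
  leaves k - 1 further points on each.\<close>

lemma card_union_if_deg_eq: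
  assumes "deg S p = k"
  shows "real (card (\<Union>S)) = real k * (real k - 1) + 1"
proof -
  have "card {b \<in> S. p \<in> b} \<noteq> 0" using assms k_gt_1 by (simp add: deg_def)
  then obtain b0 where "b0 \<in> S" "p \<in> b0" by (auto simp: card_eq_0_iff)
  then have p: "p \<in> \<Union>S" by auto
  have UP: "\<Union>S \<subseteq> P" using S_blocks block_subset by blast
  have card_U: "card (\<Union>S) > 0" using p finite_union by (auto simp: card_gt_0_iff)
  have "(\<Sum>b\<in>{b \<in> \<B>. p \<in> b}. real (card (b \<inter> (\<Union>S - {p})))) = card (\<Union>S - {p})"
    using p UP by (intro sum_card_blocks_through) auto
  also have "\<dots> = real (card (\<Union>S)) - 1"
    using p finite_union card_U by (simp add: of_nat_diff)
  also have "(\<Sum>b\<in>{b \<in> \<B>. p \<in> b}. real (card (b \<inter> (\<Union>S - {p}))))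
      = (\<Sum>b\<in>{b \<in> S. p \<in> b}. real (card (b \<inter> (\<Union>S - {p}))))"
  \<comment> \<open>A block through p outside \<open>S\<close> has no second point q in the union,
    since p and q are already joined by a block of \<open>S\<close>.\<close>
  proof (intro sum.mono_neutral_right ballI)
    fix b assume b: "b \<in> {b \<in> \<B>. p \<in> b} - {b \<in> S. p \<in> b}"
    have "b \<inter> (\<Union>S - {p}) = {}"
    proof (rule ccontr)
      assume "b \<inter> (\<Union>S - {p}) \<noteq> {}"
      then obtain q where q: "q \<in> b" "q \<in> \<Union>S" "q \<noteq> p" by blast
      obtain c where c: "c \<in> S" "p \<in> c" "q \<in> c"
        using joined_if_deg_eq[OF assms q(2)] by blast
      have "b = c" using block_unique[of b c p q] b c q S_blocks by blast
      thus False using b c by blast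
    qed
    thus "real (card (b \<inter> (\<Union>S - {p}))) = 0" by (simp only: card.empty of_nat_0)
  qed (use S_blocks finite_blocks in auto)
  also have "\<dots> = (\<Sum>b\<in>{b \<in> S. p \<in> b}. real k - 1)"
  proof (intro sum.cong refl)
    fix b assume b: "b \<in> {b \<in> S. p \<in> b}"
    then have "b \<inter> (\<Union>S - {p}) = b - {p}" "b \<in> \<B>" using S_blocks by auto
    thus "real (card (b \<inter> (\<Union>S - {p}))) = real k - 1"
      using b card_block finite_block k_gt_1 by (simp add: of_nat_diff)
  qed
  also have "\<dots> = real k * (real k - 1)" using assms by (simp add: deg_def)
  finally show ?thesis by simp
qed

lemma card_le_if_deg_le:
  assumes "b \<in> S" and "\<And>p. p \<in> b \<Longrightarrow> deg S p \<le> m"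
  shows "real (card S) + real k - 1 \<le> real k * real m"
proof -
  have "card b = k" using card_block assms S_blocks by auto
  moreover have "(\<Sum>p\<in>b. real (deg S p)) \<le> (\<Sum>p\<in>b. real m)"
    using assms by (intro sum_mono) auto
  ultimately show ?thesis using sum_deg_block[OF assms(1)] by simp
qed

text \<open>On a block through p the degrees sum to s + k - 1, and the k - 1 other points take at
  most (k - 1)^2 of this.\<close>

lemma deg_ge:
  assumes deg_le: "\<And>p. p \<in> \<Union>S \<Longrightarrow> deg S p \<le> k - 1" and p: "p \<in> \<Union>S"
  shows "real (card S) - (real k - 1) * (real k - 2) \<le> deg S p"
proof -
  obtain b where b: "b \<in> S" "p \<in> b" using p by auto
  have fin: "finite b" and card: "card b = k" using finite_block card_block b S_blocks by auto
  have "real (card S) + real k - 1 = deg S p + (\<Sum>q\<in>b - {p}. real (deg S q))"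
    using sum_deg_block[OF b(1)] sum.remove[OF fin b(2), of "\<lambda>q. real (deg S q)"] by simp
  also have "(\<Sum>q\<in>b - {p}. real (deg S q)) \<le> (\<Sum>q\<in>b - {p}. real k - 1)"
  proof (intro sum_mono)
    fix q assume "q \<in> b - {p}"
    then have "deg S q \<le> k - 1" using deg_le b by auto
    thus "real (deg S q) \<le> real k - 1" using k_gt_1 by linarith
  qed
  also have "\<dots> = (real k - 1) * (real k - 1)"
    using fin card b k_gt_1 by (simp add: of_nat_diff)
  finally show ?thesis by (simp add: algebra_simps)
qed

lemma card_union_bounds:
  fixes t :: real
  assumes deg_le: "\<And>p. p \<in> \<Union>S \<Longrightarrow> deg S p \<le> k - 1"
  defines "t \<equiv> real (card S) - (real k - 1) * (real k - 2)"
  shows "real (card S) * real k \<le> (real k - 1) * real (card (\<Union>S))"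
    and "t * real (card (\<Union>S)) \<le> real (card S) * (t + 1)"
proof -
  define n where "n = real k - 1"
  have le: "real (deg S p) \<le> n" if "p \<in> \<Union>S" for p
    using deg_le[OF that] k_gt_1 unfolding n_def by linarith
  have "(\<Sum>p\<in>\<Union>S. real (deg S p)) \<le> (\<Sum>p\<in>\<Union>S. n)"
    by (intro sum_mono le)
  thus "real (card S) * real k \<le> (real k - 1) * real (card (\<Union>S))"
    using sum_deg_union by (simp add: n_def mult.commute)
  \<comment> \<open>All degrees lie in [t, n]. Expanding the products leaves only the first two
    moments of the degrees, both known exactly.\<close>
  have "0 \<le> (\<Sum>p\<in>\<Union>S. (real (deg S p) - t) * (n - real (deg S p)))"
    using deg_ge[OF deg_le] le by (intro sum_nonneg mult_nonneg_nonneg) (auto simp: t_def)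
  also have "\<dots> = (\<Sum>p\<in>\<Union>S. (n + t) * real (deg S p) - real (deg S p) * real (deg S p) - n * t)"
    by (intro sum.cong) (auto simp: algebra_simps)
  also have "\<dots> = (n + t) * (real (card S) * real k)
      - real (card S) * (real (card S) + real k - 1) - n * t * card (\<Union>S)"
    by (simp add: sum_subtractf sum_distrib_left[symmetric] sum_deg_union sum_deg_square_union)
  also have "\<dots> = n * (real (card S) * (t + 1) - t * real (card (\<Union>S)))"
  proof -
    have "real k = n + 1" "real (card S) = n * (n - 1) + t" by (auto simp: n_def t_def)
    thus ?thesis by (simp add: algebra_simps)
  qed
  finally show "t * real (card (\<Union>S)) \<le> real (card S) * (t + 1)"
    using k_gt_1 by (simp add: n_def zero_le_mult_iff)
qed

section \<open>Large families outside every pencil\<close>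

text \<open>This serves both claims of the theorem: more than R blocks are impossible, and exactly R
  occur only for the excluded parameters.\<close>

lemma large_not_in_pencil:
  fixes R :: nat
  assumes "k \<ge> 4" and R: "\<And>x. x \<in> P \<Longrightarrow> deg \<B> x = R"
    and bound: "real R \<ge> (real k)\<^sup>2 - 3 * real k + 3 / 4 * sqrt (real k) + 2"
    and not_pencil: "\<And>p. p \<in> P \<Longrightarrow> \<exists>b\<in>S. p \<notin> b"
    and large: "R \<le> card S"
  shows "card S = R \<and> (real R = (real k)\<^sup>2 - real k + 1 \<or> R = 8 \<and> k = 4)"
proof -
  define n where "n = real k - 1"
  define r where "r = real R"
  define s where "s = real (card S)"
  define u where "u = real (card (\<Union>S))"
  have k: "real k = n + 1" and n: "3 \<le> n" using \<open>k \<ge> 4\<close> by (auto simp: n_def)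
  have rs: "r \<le> s" using large by (simp add: r_def s_def)
  obtain x where x: "x \<in> P" using card_P k_less_v by fastforce
  then obtain b where b: "b \<in> S" using not_pencil by auto
  have UP: "\<Union>S \<subseteq> P" using S_blocks block_subset by blast
  have deg_le_k: "deg S p \<le> k" if "p \<in> \<Union>S" for p
    using deg_le not_pencil that UP by blast
  then have less_k: "deg S p \<le> k - 1" if "p \<in> \<Union>S" "deg S p \<noteq> k" for p
    using that by force
  have s_le: "s \<le> n * n + n + 1"
    using card_le_if_deg_le[OF b, of k] deg_le_k b by (auto simp: s_def k algebra_simps)
  have v: "real v = r * n + 1" using deg_blocks[OF x] R[OF x] by (simp add: n_def r_def)
  have "2 * (r * n + 1 - u) * (u - r) \<le> (n - 1) * (u * (u - 1) - s * (n + 1) * n)"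
    using outer_point_inequality[OF S_blocks R] by (simp add: v k r_def[symmetric] s_def u_def)
  \<comment> \<open>After substituting u = r + x, the mixed terms in r and x cancel.\<close>
  then have ineq: "(n - 1) * (r * (n * n + n + 1 - r) + (s - r) * n * (n + 1))
               \<le> (n + 1) * (u - r) * (u - r - 1)"
    by (simp add: algebra_simps)
  consider "n * n + n + 1 \<le> r" | p where "r < n * n + n + 1" "p \<in> \<Union>S" "deg S p = k"
    | "r < n * n + n + 1" "\<And>p. p \<in> \<Union>S \<Longrightarrow> deg S p \<le> k - 1"
    using less_k by (meson not_le)
  thus ?thesis
  proof cases
    case 1
    then have "s = r" "r = n * n + n + 1" using s_le rs by auto
    thus ?thesis by (simp add: s_def r_def k power2_eq_square algebra_simps)
  next
    case 2
    define e where "e = n * n + n + 1 - r"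
    have e: "0 < e" using 2 by (simp add: e_def)
    have "u - r = e"
      using card_union_if_deg_eq[OF 2(3)] by (simp add: u_def e_def k algebra_simps)
    then have "(n - 1) * (r * e + (s - r) * n * (n + 1)) \<le> (n + 1) * e * (e - 1)"
      using ineq by (simp only: e_def)
    then have "n * ((n - 1) * ((s - r) * (n + 1))) \<le> e * ((n + 1) * (e - 1) - (n - 1) * r)"
      by (simp add: algebra_simps)
    also have "(n + 1) * (e - 1) - (n - 1) * r = n * ((n + 1)\<^sup>2 - 2 * r)"
      by (simp add: e_def power2_eq_square algebra_simps)
    finally have "n * ((n - 1) * ((s - r) * (n + 1))) \<le> n * (e * ((n + 1)\<^sup>2 - 2 * r))"
      by (simp only: mult.left_commute)
    \<comment> \<open>The term with s - r is kept because this is used twice: first for 2 r <= k^2,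
      then, once 2 r = k^2, for s <= r.\<close>
    then have *: "(n - 1) * ((s - r) * (n + 1)) \<le> e * ((real k)\<^sup>2 - 2 * r)"
      using n by (simp add: k)
    moreover have "0 \<le> (n - 1) * ((s - r) * (n + 1))" using n rs by simp
    ultimately have "0 \<le> e * ((real k)\<^sup>2 - 2 * r)" by linarith
    then have 2: "2 * r \<le> (real k)\<^sup>2" using e by (simp add: zero_le_mult_iff)
    have sqrt: "2 \<le> sqrt (real k)" using \<open>k \<ge> 4\<close> by (intro real_le_rsqrt) auto
    have "k = 4"
    proof (rule ccontr)
      assume "k \<noteq> 4"
      then have "5 \<le> real k" using \<open>k \<ge> 4\<close> by auto
      \<comment> \<open>With sqrt k >= 2, the hypothesis on r and 2 r <= k^2 give k^2 - 6 k + 7 <=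
        0, which this product refutes.\<close>
      then have "0 \<le> (real k - 5) * (real k - 1)" by simp
      thus False using bound sqrt 2 by (simp add: r_def power2_eq_square algebra_simps)
    qed
    \<comment> \<open>For k = 4 the bounds read 15/2 <= R <= 8.\<close>
    moreover from this have "R = 8" using 2 bound sqrt by (simp add: r_def)
    moreover from calculation have "s \<le> r" using * by (simp add: r_def n_def)
    ultimately show ?thesis using rs by (auto simp: s_def r_def)
  next
    case 3
    \<comment> \<open>Integer copies are needed for \<open>size_gap_inequality\<close>. As k^2 - 3 k
      + 2 = n (n - 1), the hypothesis on r says precisely T >= 3/4 sqrt k.\<close>
    define N where "N = int k - 1"
    define T where "T = int R - N * (N - 1)"
    define T' where "T' = int (card S) - N * (N - 1)"
    have N: "real_of_int N = n" by (simp add: N_def n_def)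
    have T: "real_of_int T = r - n * (n - 1)" and T': "real_of_int T' = s - n * (n - 1)"
      by (simp_all add: T_def T'_def r_def s_def N)
    have T_ge: "3 / 4 * sqrt (real k) \<le> T"
      using bound by (simp add: T r_def k power2_eq_square algebra_simps)
    have T_pos: "0 < T"
    proof -
      have "0 < 3 / 4 * sqrt (real k)" using k_gt_1 by simp
      thus ?thesis using T_ge by linarith
    qed
    have T_square: "9 * (N + 1) \<le> 16 * T\<^sup>2"
    proof -
      have "(3 / 4 * sqrt (real k))\<^sup>2 \<le> (real_of_int T)\<^sup>2"
        using T_ge by (intro power_mono) auto
      then have "9 * (real_of_int N + 1) \<le> 16 * (real_of_int T)\<^sup>2"
        by (simp add: power_mult_distrib N n_def power_divide)
      thus ?thesis by (simp flip: of_int_le_iff[where 'a = real])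
    qed
    have TT': "T \<le> T'" using large by (simp add: T_def T'_def)
    have T'_le: "T' \<le> N"
    proof -
      have "s + n \<le> (n + 1) * n"
        using card_le_if_deg_le[OF b, of "k - 1"] 3 b k_gt_1
        by (auto simp: s_def k of_nat_diff)
      then have "real_of_int T' \<le> real_of_int N" by (simp add: T' N algebra_simps)
      thus ?thesis by simp
    qed
    \<comment> \<open>If T < T' <= N, then T <= N - 1 by integrality.\<close>
    have "T = T' \<or> T * T' \<le> N * (N - 1)"
    proof (cases "T = T'")
      case False
      then have "T * T' \<le> (N - 1) * N" using T_pos TT' T'_le by (intro mult_mono) auto
      thus ?thesis by (simp add: mult.commute)
    qed simp
    then have "T = T' \<or> real_of_int (T * T') \<le> real_of_int (N * (N - 1))"
      by (simp only: of_int_le_iff)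
    then have prod: "real_of_int T = real_of_int T' \<or>
        real_of_int T * real_of_int T' \<le> n * (n - 1)"
      by (auto simp: N)
    have t_eq: "s - (real k - 1) * (real k - 2) = T'" by (simp add: T' k algebra_simps)
    have u_lower: "s * (n + 1) \<le> n * u"
      using card_union_bounds(1)[OF 3(2)] by (simp add: s_def[symmetric] u_def[symmetric] k)
    have u_upper: "T' * u \<le> s * (T' + 1)"
      using card_union_bounds(2)[OF 3(2), folded s_def u_def, unfolded t_eq] by simp
    have "r * n \<le> s * (n + 1)"
      using n rs by (intro mult_mono) (auto simp: r_def s_def)
    then have "n * r \<le> n * u" using u_lower by (simp only: mult.commute)
    then have "r \<le> u" using n by simp
    then have "(real_of_int T)\<^sup>2 * (2 * n + 1 - T) \<le> n * (n + 1)"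
    proof (intro low_degree_inequality[of n _ T' r s u])
      show "r = n * (n - 1) + T" "s = n * (n - 1) + T'" by (simp_all add: T T')
    qed (use n T_pos TT' prod u_upper ineq in simp_all)
    then have "real_of_int (T\<^sup>2 * (2 * N + 1 - T)) \<le> real_of_int (N * (N + 1))"
      by (simp add: N)
    then have "T\<^sup>2 * (2 * N + 1 - T) \<le> N * (N + 1)" by (simp only: of_int_le_iff)
    moreover have "N * (N + 1) < T\<^sup>2 * (2 * N + 1 - T)"
      using T_pos TT' T'_le T_square \<open>k \<ge> 4\<close> by (intro size_gap_inequality) (auto simp: N_def)
    ultimately show ?thesis by simp
  qed
qed

end

theorem corollary5p6:
  fixes P :: "'a set" and \<B> S :: "'a set set" and v k :: nat and r :: real
  assumes "design P \<B> v k"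
    and "k \<ge> 4"
    and "r = (real v - 1) / (real k - 1)"
    and "r \<ge> (real k)^2 - 3 * real k + 3 / 4 * sqrt (real k) + 2"
    and "EKR_set \<B> S"
  shows "real (card S) \<le> r \<and>
    (r \<noteq> (real k)^2 - real k + 1 \<and> (r, k) \<noteq> (8, 4) \<longrightarrow>
      (real (card S) = r \<longleftrightarrow> point_pencil P \<B> S))"
proof -
  interpret intersecting_family P \<B> v k S
    using assms by unfold_locales
  obtain x where x: "x \<in> P" using card_P k_less_v by fastforce
  have deg: "real (deg \<B> y) = r" if "y \<in> P" for y
    using deg_blocks[OF that] assms(2,3) by (subst assms(3), subst eq_divide_eq) auto
  \<comment> \<open>The quotient r is thus a natural number, the number of blocks through any
    point.\<close>
  define R where "R = deg \<B> x"
  have r: "r = real R" using deg[OF x] by (simp add: R_def)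
  have R: "deg \<B> y = R" if "y \<in> P" for y
    using deg[OF that] r by simp
  have pencil: "real (card S) = r" if "point_pencil P \<B> S"
    using that R r by (auto simp: point_pencil_def deg_def)
  show ?thesis
  \<comment> \<open>A family inside a pencil has at most R blocks, and equality makes it the whole
    pencil. The empty family also falls into this case.\<close>
  proof (cases "\<exists>p\<in>P. \<forall>b\<in>S. p \<in> b")
    case True
    then obtain p where p: "p \<in> P" "S \<subseteq> {b \<in> \<B>. p \<in> b}" using S_blocks by auto
    have card: "card {b \<in> \<B>. p \<in> b} = R" using R[OF p(1)] by (simp add: deg_def)
    have fin: "finite {b \<in> \<B>. p \<in> b}" using finite_blocks by simp
    have "card S \<le> R" using card_mono[OF fin p(2)] card by simp
    moreover have "point_pencil P \<B> S" if "card S = R"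
      using card_subset_eq[OF fin p(2)] card that p(1) by (auto simp: point_pencil_def)
    ultimately show ?thesis using r pencil by auto
  next
    case False
    have large: "card S = R \<and> (real R = (real k)\<^sup>2 - real k + 1 \<or> R = 8 \<and> k = 4)"
      if "R \<le> card S"
    proof (rule large_not_in_pencil)
      show "(real k)\<^sup>2 - 3 * real k + 3 / 4 * sqrt (real k) + 2 \<le> real R"
        using assms(4) r by simp
    qed (use that assms(2) R False in auto)
    then have "card S \<le> R" by linarith
    moreover have "card S \<noteq> R" if "r \<noteq> (real k)\<^sup>2 - real k + 1" "(r, k) \<noteq> (8, 4)"
      using large that r by auto
    ultimately show ?thesis using pencil r by auto
  qed
qed

end
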